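(* Let $M$ be a proper set system over $V$ such that $M\bar{*}V$ is even. Then $P_M(y)=(-1)^{d_{M*V}}Q_{[1,1,0]}(M\bar{*}V)(-y)$. In particular, $P_M(-1)=(-1)^{d_{M*V}}2^{|V|}$. If moreover $M$ is a vf-safe $\Delta$-matroid, then $P_M(2)=(-1)^{d_M+d_{M*V}+|V|}2^{d_M}$.
   Context: A set system $N=(V,D)$ is proper if $D\ne\emptyset$ and even if all members of $D$ have cardinalities of the same parity. Twist $N*X=(V,\{Y\triangle X:Y\in D\})$; loop complementation $N+X=(V,D')$ with $Y\in D'$ iff the number of $W\in D$ with $Y\setminus X\subseteq W\subseteq Y$ is odd; dual pivot $N\bar{*}X=(V,D'')$ with $Y\in D''$ iff the number of $W\in D$ with $Y\subseteq W\subseteq Y\cup X$ is odd; operations are applied left to right. $d_N=\min\{|Y|:Y\in D\}$. $P_M(y)=\sum_{X\subseteq V}(-1)^{|X|}y^{d_{M*V\bar{*}X}}$, and $Q_{[1,1,0]}(N)(y)=\sum_{B\subseteq V}y^{d_{N*B}}$. A $\Delta$-matroid is a proper set system such that for all $X,Y\in D$, $x\in X\triangle Y$ there is $y\in X\triangle Y$ (possibly $y=x$) with $X\triangle\{x,y\}\in D$; it is vf-safe if every set system obtained from it by finite sequences of twists and loop complementations is a $\Delta$-matroid. *)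

theory Defs
  imports "HOL-Computational_Algebra.Polynomial"
begin

type_synonym 'a set_system = "'a set \<times> 'a set set"

definition ground :: "'a set_system \<Rightarrow> 'a set" where
  "ground N = fst N"

definition members :: "'a set_system \<Rightarrow> 'a set set" where
  "members N = snd N"

definition set_system :: "'a set_system \<Rightarrow> bool" where
  "set_system N \<longleftrightarrow> finite (ground N) \<and> members N \<subseteq> Pow (ground N)"

definition proper_system :: "'a set_system \<Rightarrow> bool" where
  "proper_system N \<longleftrightarrow> members N \<noteq> {}"

definition even_system :: "'a set_system \<Rightarrow> bool" where
  "even_system N \<longleftrightarrow>
     (\<forall>X \<in> members N. \<forall>Y \<in> members N. even (card X) \<longleftrightarrow> even (card Y))"

text \<open>The operations below are meant for subsets of the ground set only. They are
  left-associative, so that compositions read from left to right.\<close>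

definition twist :: "'a set_system \<Rightarrow> 'a set \<Rightarrow> 'a set_system"  (infixl "\<^bold>*" 65) where
  "N \<^bold>* X = (ground N, {sym_diff Y X | Y. Y \<in> members N})"

definition loop_compl :: "'a set_system \<Rightarrow> 'a set \<Rightarrow> 'a set_system"  (infixl "\<^bold>+" 65) where
  "N \<^bold>+ X = (ground N,
     {Y. Y \<subseteq> ground N \<and> odd (card {W \<in> members N. Y - X \<subseteq> W \<and> W \<subseteq> Y})})"

definition dual_pivot :: "'a set_system \<Rightarrow> 'a set \<Rightarrow> 'a set_system"  (infixl "\<^bold>*\<^bold>-" 65) where
  "N \<^bold>*\<^bold>- X = (ground N,
     {Y. Y \<subseteq> ground N \<and> odd (card {W \<in> members N. Y \<subseteq> W \<and> W \<subseteq> Y \<union> X})})"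

text \<open>The minimum is meaningful for proper set systems only; properness is preserved by
  all three operations.\<close>

definition min_size :: "'a set_system \<Rightarrow> nat" where
  "min_size N = Min (card ` members N)"

definition P_poly :: "'a set_system \<Rightarrow> int poly" where
  "P_poly M = (\<Sum>X \<in> Pow (ground M).
     (-1) ^ card X * monom 1 (min_size (M \<^bold>* ground M \<^bold>*\<^bold>- X)))"

definition Q110_poly :: "'a set_system \<Rightarrow> int poly" where
  "Q110_poly N = (\<Sum>B \<in> Pow (ground N). monom 1 (min_size (N \<^bold>* B)))"

definition delta_matroid :: "'a set_system \<Rightarrow> bool" where
  "delta_matroid N \<longleftrightarrow> set_system N \<and> proper_system N \<and>
     (\<forall>X \<in> members N. \<forall>Y \<in> members N. \<forall>x \<in> sym_diff X Y.
        \<exists>y \<in> sym_diff X Y. sym_diff X {x, y} \<in> members N)"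

inductive vf_reachable :: "'a set_system \<Rightarrow> 'a set_system \<Rightarrow> bool" for M where
  refl: "vf_reachable M M"
| twist: "vf_reachable M N \<Longrightarrow> X \<subseteq> ground N \<Longrightarrow> vf_reachable M (N \<^bold>* X)"
| loop_compl: "vf_reachable M N \<Longrightarrow> X \<subseteq> ground N \<Longrightarrow> vf_reachable M (N \<^bold>+ X)"

definition vf_safe_delta_matroid :: "'a set_system \<Rightarrow> bool" where
  "vf_safe_delta_matroid M \<longleftrightarrow>
     delta_matroid M \<and> (\<forall>N. vf_reachable M N \<longrightarrow> delta_matroid N)"

end

theory Submission
  imports Defs
begin

text \<open>
  On each element of the ground set the operations act as permutations of order 2 generating a
  copy of \<open>S\<^sub>3\<close>, so that \<open>M \<^bold>* V \<^bold>*\<^bold>- X = N \<^bold>* (V - X) \<^bold>+ V\<close> for \<open>N = M \<^bold>*\<^bold>- V\<close>. Loop complementation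
  at \<open>V\<close> preserves the members of minimum size, and evenness of \<open>N\<close> converts the sign
  \<open>(-1) ^ card X\<close> into the parity of the exponent; this gives the first identity.

  For the value at 2, let \<open>S\<close> be vf-safe and \<open>v\<close> in its ground set. An exchange argument shows that
  among the minimum sizes of \<open>S\<close>, \<open>S \<^bold>* {v}\<close> and \<open>S \<^bold>*\<^bold>- {v}\<close> two are equal to some \<open>m\<close> and the third
  is \<open>m + 1\<close>. Hence the three powers of \<open>-2\<close> sum to 0, and the sum over all \<open>B \<subseteq> V\<close> of the powers
  belonging to \<open>N \<^bold>* B\<close> collapses one element at a time.
\<close>

section \<open>Counting modulo 2\<close>

text \<open>Double counting of the pairs with \<open>P W R\<close>, read modulo 2. It opens up
  composed operations, where membership is a parity of sets that are themselves selected by a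
  parity.\<close>

lemma odd_card_swap:
  assumes "finite F" "finite G"
  shows "odd (card {W \<in> G. odd (card {R \<in> F. P W R})}) \<longleftrightarrow>
         odd (card {R \<in> F. odd (card {W \<in> G. P W R})})"
proof -
  have "(\<Sum>W\<in>G. card {R \<in> F. P W R}) = (\<Sum>R\<in>F. card {W \<in> G. P W R})"
    using sum.swap_restrict[OF assms(2,1), of "\<lambda>_ _. 1::nat" P] by simp
  then show ?thesis
    using even_sum_iff[OF assms(2), of "\<lambda>W. card {R \<in> F. P W R}"]
      even_sum_iff[OF assms(1), of "\<lambda>R. card {W \<in> G. P W R}"] by simp
qed

text \<open>A nonempty interval has \<open>2 ^ card (B - A)\<close> elements. After a swap of
  counts, only the intervals with equal endpoints survive modulo 2.\<close>

lemma odd_card_interval: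
  assumes "finite B"
  shows "odd (card {U. A \<subseteq> U \<and> U \<subseteq> B}) \<longleftrightarrow> A = B"
proof (cases "A \<subseteq> B")
  case True
  have "bij_betw (\<lambda>U. U - A) {U. A \<subseteq> U \<and> U \<subseteq> B} (Pow (B - A))"
    by (rule bij_betw_byWitness[where f' = "\<lambda>U. U \<union> A"]) (use True in auto)
  then have "card {U. A \<subseteq> U \<and> U \<subseteq> B} = 2 ^ card (B - A)"
    using assms by (simp add: bij_betw_same_card card_Pow)
  moreover have "card (B - A) = 0 \<longleftrightarrow> A = B"
    using True assms by auto
  ultimately show ?thesis by simp
next
  case False
  then have "{U. A \<subseteq> U \<and> U \<subseteq> B} = {}" "A \<noteq> B" by blast+
  then show ?thesis by (simp only: card.empty) simp
qed

section \<open>Membership under the operations\<close>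

lemma set_system_finite_members: "set_system N \<Longrightarrow> finite (members N)"
  unfolding set_system_def by (meson finite_Pow_iff finite_subset)

lemma member_subset_ground: "set_system N \<Longrightarrow> W \<in> members N \<Longrightarrow> W \<subseteq> ground N"
  unfolding set_system_def by auto

lemma finite_member: "set_system N \<Longrightarrow> W \<in> members N \<Longrightarrow> finite W"
  unfolding set_system_def by (meson PowD finite_subset subsetD)

lemma ground_operations [simp]:
  "ground (N \<^bold>* X) = ground N" "ground (N \<^bold>+ X) = ground N" "ground (N \<^bold>*\<^bold>- X) = ground N"
  by (simp_all add: twist_def loop_compl_def dual_pivot_def ground_def)

lemma in_members_twist: "W \<in> members (N \<^bold>* X) \<longleftrightarrow> sym_diff W X \<in> members N"
proof -
  have inv: "sym_diff (sym_diff Y X) X = Y" for Y by auto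
  have "W \<in> members (N \<^bold>* X) \<longleftrightarrow> (\<exists>Y. W = sym_diff Y X \<and> Y \<in> members N)"
    by (simp add: twist_def members_def)
  then show ?thesis by (metis inv)
qed

lemma in_members_loop_compl:
  "Y \<in> members (N \<^bold>+ X) \<longleftrightarrow>
     Y \<subseteq> ground N \<and> odd (card {W \<in> members N. Y - X \<subseteq> W \<and> W \<subseteq> Y})"
  by (simp add: loop_compl_def members_def)

lemma in_members_dual_pivot:
  "Y \<in> members (N \<^bold>*\<^bold>- X) \<longleftrightarrow>
     Y \<subseteq> ground N \<and> odd (card {W \<in> members N. Y \<subseteq> W \<and> W \<subseteq> Y \<union> X})"
  by (simp add: dual_pivot_def members_def)

lemma set_system_eqI:
  "ground N = ground N' \<Longrightarrow> (\<And>Y. Y \<in> members N \<longleftrightarrow> Y \<in> members N') \<Longrightarrow> N = N'"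
  by (auto simp: ground_def members_def prod_eq_iff)

lemma dual_pivot_empty:
  assumes "set_system N"
  shows "N \<^bold>*\<^bold>- {} = N"
proof (rule set_system_eqI)
  fix Y
  have "{W \<in> members N. Y \<subseteq> W \<and> W \<subseteq> Y} = (if Y \<in> members N then {Y} else {})"
    by auto
  then show "Y \<in> members (N \<^bold>*\<^bold>- {}) \<longleftrightarrow> Y \<in> members N"
    using member_subset_ground[OF assms] by (auto simp: in_members_dual_pivot)
qed simp

lemma twist_empty: "N \<^bold>* {} = N"
  by (rule set_system_eqI) (simp_all add: in_members_twist)

lemma set_system_twist: "set_system N \<Longrightarrow> X \<subseteq> ground N \<Longrightarrow> set_system (N \<^bold>* X)"
  unfolding set_system_def by (auto simp: in_members_twist subset_iff)

lemma set_system_loop_compl: "set_system N \<Longrightarrow> set_system (N \<^bold>+ X)"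
  unfolding set_system_def by (auto simp: in_members_loop_compl)

lemma set_system_dual_pivot: "set_system N \<Longrightarrow> set_system (N \<^bold>*\<^bold>- X)"
  unfolding set_system_def by (auto simp: in_members_dual_pivot)

lemma proper_system_twist: "proper_system N \<Longrightarrow> proper_system (N \<^bold>* X)"
proof -
  have "W \<in> members N \<Longrightarrow> sym_diff W X \<in> members (N \<^bold>* X)" for W
  proof -
    have "sym_diff (sym_diff W X) X = W" by auto
    then show "W \<in> members N \<Longrightarrow> ?thesis" by (simp add: in_members_twist)
  qed
  then show "proper_system N \<Longrightarrow> ?thesis" unfolding proper_system_def by blast
qed

section \<open>Algebra of the operations\<close>

lemma twist_twist_disjoint: "X \<inter> Y = {} \<Longrightarrow> N \<^bold>* X \<^bold>* Y = N \<^bold>* (X \<union> Y)"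
proof (rule set_system_eqI)
  fix W assume "X \<inter> Y = {}"
  then have "sym_diff (sym_diff W Y) X = sym_diff W (X \<union> Y)" by auto
  then show "W \<in> members (N \<^bold>* X \<^bold>* Y) \<longleftrightarrow> W \<in> members (N \<^bold>* (X \<union> Y))"
    by (simp add: in_members_twist)
qed simp

text \<open>For a fixed \<open>R\<close>, the intermediate sets \<open>W\<close> form the interval
  from \<open>Y \<union> (R - A)\<close> to \<open>(Y \<union> B) \<inter> R\<close>, which counts
  only when its ends coincide. \<open>A\<close> and \<open>B\<close> stay arbitrary so that both the
  disjoint case and the case \<open>A = B\<close> can be read off.\<close>

lemma in_members_dual_pivot_dual_pivot:
  assumes "set_system N" "B \<subseteq> ground N"
  shows "Y \<in> members (N \<^bold>*\<^bold>- A \<^bold>*\<^bold>- B) \<longleftrightarrow>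
     Y \<subseteq> ground N \<and> odd (card {R \<in> members N. Y \<union> (R - A) = (Y \<union> B) \<inter> R})"
proof (cases "Y \<subseteq> ground N")
  case True
  let ?G = "{W \<in> Pow (ground N). Y \<subseteq> W \<and> W \<subseteq> Y \<union> B}"
  have fin: "finite (members N)" "finite ?G"
    using assms by (auto simp: set_system_def set_system_finite_members)
  have "{W \<in> members (N \<^bold>*\<^bold>- A). Y \<subseteq> W \<and> W \<subseteq> Y \<union> B}
      = {W \<in> ?G. odd (card {R \<in> members N. W \<subseteq> R \<and> R \<subseteq> W \<union> A})}"
    by (auto simp: in_members_dual_pivot)
  then have "Y \<in> members (N \<^bold>*\<^bold>- A \<^bold>*\<^bold>- B) \<longleftrightarrow>
      odd (card {R \<in> members N. odd (card {W \<in> ?G. W \<subseteq> R \<and> R \<subseteq> W \<union> A})})"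
    using True odd_card_swap[OF fin, of "\<lambda>W R. W \<subseteq> R \<and> R \<subseteq> W \<union> A"]
    by (simp add: in_members_dual_pivot)
  moreover have "odd (card {W \<in> ?G. W \<subseteq> R \<and> R \<subseteq> W \<union> A}) \<longleftrightarrow> Y \<union> (R - A) = (Y \<union> B) \<inter> R"
    if "R \<in> members N" for R
  proof -
    have "{W \<in> ?G. W \<subseteq> R \<and> R \<subseteq> W \<union> A} = {W. Y \<union> (R - A) \<subseteq> W \<and> W \<subseteq> (Y \<union> B) \<inter> R}"
      using member_subset_ground[OF assms(1) that] by auto
    then show ?thesis
      using finite_member[OF assms(1) that] by (simp only: odd_card_interval finite_Int simp_thms)
  qed
  ultimately show ?thesis using True by (simp cong: conj_cong)
qed (simp add: in_members_dual_pivot)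

lemma dual_pivot_dual_pivot_disjoint:
  assumes "set_system N" "B \<subseteq> ground N" "A \<inter> B = {}"
  shows "N \<^bold>*\<^bold>- A \<^bold>*\<^bold>- B = N \<^bold>*\<^bold>- (A \<union> B)"
proof (rule set_system_eqI)
  fix Y
  have "Y \<union> (R - A) = (Y \<union> B) \<inter> R \<longleftrightarrow> Y \<subseteq> R \<and> R \<subseteq> Y \<union> (A \<union> B)" for R
    using assms(3) by blast
  then show "Y \<in> members (N \<^bold>*\<^bold>- A \<^bold>*\<^bold>- B) \<longleftrightarrow> Y \<in> members (N \<^bold>*\<^bold>- (A \<union> B))"
    by (simp add: in_members_dual_pivot_dual_pivot[OF assms(1,2)]
        in_members_dual_pivot[of Y N "A \<union> B"])
qed simp

lemma dual_pivot_involution: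
  assumes "set_system N" "X \<subseteq> ground N"
  shows "N \<^bold>*\<^bold>- X \<^bold>*\<^bold>- X = N"
proof (rule set_system_eqI)
  fix Y
  have "Y \<union> (R - X) = (Y \<union> X) \<inter> R \<longleftrightarrow> R = Y" for R
    by blast
  moreover have "{R \<in> members N. R = Y} = (if Y \<in> members N then {Y} else {})" by auto
  ultimately show "Y \<in> members (N \<^bold>*\<^bold>- X \<^bold>*\<^bold>- X) \<longleftrightarrow> Y \<in> members N"
    using member_subset_ground[OF assms(1)]
    by (auto simp: in_members_dual_pivot_dual_pivot[OF assms])
qed simp

text \<open>A dual pivot of a system without members has no members, so the involution would leave
  none in \<open>N\<close>.\<close>

lemma proper_system_dual_pivot:
  assumes "set_system N" "X \<subseteq> ground N" "proper_system N"
  shows "proper_system (N \<^bold>*\<^bold>- X)"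
proof (rule ccontr)
  assume "\<not> proper_system (N \<^bold>*\<^bold>- X)"
  then have "members (N \<^bold>*\<^bold>- X \<^bold>*\<^bold>- X) = {}"
    by (auto simp: proper_system_def in_members_dual_pivot[of _ "N \<^bold>*\<^bold>- X"])
  then show False
    using assms by (simp add: dual_pivot_involution proper_system_def)
qed

lemma card_members_twist:
  "card {W \<in> members (N \<^bold>* X). P W} = card {T \<in> members N. P (sym_diff T X)}"
proof -
  have inv: "sym_diff (sym_diff Y X) X = Y" for Y by auto
  have "bij_betw (\<lambda>W. sym_diff W X) {W \<in> members (N \<^bold>* X). P W} {T \<in> members N. P (sym_diff T X)}"
    by (rule bij_betw_byWitness[where f' = "\<lambda>W. sym_diff W X"])
      (auto simp only: inv in_members_twist mem_Collect_eq image_iff)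
  then show ?thesis by (rule bij_betw_same_card)
qed

text \<open>On \<open>X\<close>, being disjoint from \<open>Y\<close>, each counted set must agree
  with \<open>W\<close>; flipping both there keeps the agreement.\<close>

lemma twist_dual_pivot_disjoint:
  assumes "X \<inter> Y = {}" "X \<subseteq> ground N"
  shows "N \<^bold>* X \<^bold>*\<^bold>- Y = N \<^bold>*\<^bold>- Y \<^bold>* X"
proof (rule set_system_eqI)
  fix W
  have "W \<subseteq> sym_diff T X \<and> sym_diff T X \<subseteq> W \<union> Y \<longleftrightarrow>
      sym_diff W X \<subseteq> T \<and> T \<subseteq> sym_diff W X \<union> Y" for T
    using assms(1) by blast
  moreover have "W \<subseteq> ground N \<longleftrightarrow> sym_diff W X \<subseteq> ground N"
    using assms(2) by blast
  ultimately show "W \<in> members (N \<^bold>* X \<^bold>*\<^bold>- Y) \<longleftrightarrow> W \<in> members (N \<^bold>*\<^bold>- Y \<^bold>* X)"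
    unfolding in_members_dual_pivot[of W "N \<^bold>* X"] card_members_twist
    by (simp only: in_members_twist in_members_dual_pivot ground_operations)
qed simp

text \<open>Flipping \<open>X\<close> reverses inclusion there and exchanges the intervals of the
  two operations. This makes dual pivots available to \<open>vf_reachable\<close>, which is
  generated by twists and loop complementations.\<close>

lemma dual_pivot_eq_twist_loop_compl_twist:
  assumes "X \<subseteq> ground N"
  shows "N \<^bold>*\<^bold>- X = N \<^bold>* X \<^bold>+ X \<^bold>* X"
proof (rule set_system_eqI)
  fix W
  have "sym_diff W X - X \<subseteq> sym_diff T X \<and> sym_diff T X \<subseteq> sym_diff W X \<longleftrightarrow>
      W \<subseteq> T \<and> T \<subseteq> W \<union> X" for T
    by blast
  moreover have "W \<subseteq> ground N \<longleftrightarrow> sym_diff W X \<subseteq> ground N"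
    using assms by blast
  ultimately show "W \<in> members (N \<^bold>*\<^bold>- X) \<longleftrightarrow> W \<in> members (N \<^bold>* X \<^bold>+ X \<^bold>* X)"
    unfolding in_members_twist[of W "N \<^bold>* X \<^bold>+ X"] in_members_loop_compl card_members_twist
    by (simp only: in_members_dual_pivot ground_operations)
qed simp

text \<open>Counting the pairs \<open>U \<subseteq> R\<close> with \<open>R\<close> a member of \<open>M\<close> in two ways, only the singleton
  intervals of sets \<open>U\<close> contribute modulo 2.\<close>

lemma twist_ground_dual_pivot:
  assumes "set_system M" "X \<subseteq> ground M"
  shows "M \<^bold>* ground M \<^bold>*\<^bold>- X = M \<^bold>*\<^bold>- ground M \<^bold>* (ground M - X) \<^bold>+ ground M"
proof (rule set_system_eqI)
  fix Y
  define V where "V = ground M"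
  have V: "X \<subseteq> V" "finite V" "\<And>R. R \<in> members M \<Longrightarrow> R \<subseteq> V"
    using assms member_subset_ground by (auto simp: V_def set_system_def)
  show "Y \<in> members (M \<^bold>* ground M \<^bold>*\<^bold>- X) \<longleftrightarrow>
      Y \<in> members (M \<^bold>*\<^bold>- ground M \<^bold>* (ground M - X) \<^bold>+ ground M)"
  proof (cases "Y \<subseteq> V")
    case True
    let ?G = "{U \<in> Pow V. sym_diff U (V - X) \<subseteq> Y}"
    have fin: "finite (members M)" "finite ?G"
      using V assms by (auto simp: set_system_finite_members)
    have eq: "{U \<in> members (M \<^bold>*\<^bold>- V). Y - V \<subseteq> sym_diff U (V - X) \<and> sym_diff U (V - X) \<subseteq> Y}
        = {U \<in> ?G. odd (card {R \<in> members M. U \<subseteq> R})}"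
    proof -
      have "{R \<in> members M. U \<subseteq> R \<and> R \<subseteq> U \<union> V} = {R \<in> members M. U \<subseteq> R}" for U
        using V(3) by blast
      moreover have "Y - V = {}" using True by blast
      ultimately show ?thesis
        by (auto simp: in_members_dual_pivot V_def[symmetric])
    qed
    have "Y \<in> members (M \<^bold>*\<^bold>- V \<^bold>* (V - X) \<^bold>+ V) \<longleftrightarrow>
        odd (card {U \<in> ?G. odd (card {R \<in> members M. U \<subseteq> R})})"
      using True
      by (simp only: in_members_loop_compl ground_operations card_members_twist V_def[symmetric] eq)
        simp
    also have "\<dots> \<longleftrightarrow> odd (card {R \<in> members M. odd (card {U \<in> ?G. U \<subseteq> R})})"
      by (rule odd_card_swap[OF fin])
    also have "{R \<in> members M. odd (card {U \<in> ?G. U \<subseteq> R})} =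
        {R \<in> members M. Y \<subseteq> sym_diff R V \<and> sym_diff R V \<subseteq> Y \<union> X}"
    proof (rule Collect_cong, rule conj_cong[OF HOL.refl])
      fix R assume R: "R \<in> members M"
      \<comment> \<open>Inside \<open>V\<close>, the condition of \<open>?G\<close> says that
        \<open>U\<close> contains \<open>V - X - Y\<close> and lies within
        \<open>Y \<union> (V - X)\<close>.\<close>
      have "{U \<in> ?G. U \<subseteq> R} = {U. V - X - Y \<subseteq> U \<and> U \<subseteq> R \<inter> (Y \<union> (V - X))}"
        using V(1) V(3)[OF R] by blast
      then have "odd (card {U \<in> ?G. U \<subseteq> R}) \<longleftrightarrow> V - X - Y = R \<inter> (Y \<union> (V - X))"
        using finite_member[OF assms(1) R] by (simp only: odd_card_interval finite_Int simp_thms)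
      also have "\<dots> \<longleftrightarrow> Y \<subseteq> sym_diff R V \<and> sym_diff R V \<subseteq> Y \<union> X"
        using V(1) V(3)[OF R] True by blast
      finally show "odd (card {U \<in> ?G. U \<subseteq> R}) \<longleftrightarrow> Y \<subseteq> sym_diff R V \<and> sym_diff R V \<subseteq> Y \<union> X" .
    qed
    finally show ?thesis
      using True by (simp add: in_members_dual_pivot card_members_twist V_def[symmetric])
  qed (simp add: in_members_dual_pivot in_members_loop_compl V_def)
qed simp

section \<open>Minimum sizes and their parity\<close>

lemma min_size_eqI:
  assumes "set_system N" "W \<in> members N" "card W = k" "\<And>W. W \<in> members N \<Longrightarrow> k \<le> card W"
  shows "min_size N = k"
  unfolding min_size_def
  by (rule Min_eqI) (use assms set_system_finite_members[OF assms(1)] in auto)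

lemma min_size_le: "set_system N \<Longrightarrow> W \<in> members N \<Longrightarrow> min_size N \<le> card W"
  unfolding min_size_def by (simp add: set_system_finite_members)

lemma min_size_attained:
  assumes "set_system N" "proper_system N"
  obtains W where "W \<in> members N" "card W = min_size N"
proof -
  have "min_size N \<in> card ` members N"
    unfolding min_size_def
    by (rule Min_in) (use assms in \<open>auto simp: set_system_finite_members proper_system_def\<close>)
  then show ?thesis using that by auto
qed

text \<open>A member of minimum size contains no other member, so it is counted once and survives;
  conversely each new member contains an old one.\<close>

lemma min_size_loop_compl_ground:
  assumes "set_system N" "proper_system N"
  shows "min_size (N \<^bold>+ ground N) = min_size N"
proof -
  obtain W where W: "W \<in> members N" "card W = min_size N"
    using min_size_attained assms by blast
  have "{U \<in> members N. U \<subseteq> W} = {W}"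
    using W min_size_le[OF assms(1)] finite_member[OF assms(1) W(1)]
    by (auto dest: card_seteq)
  moreover have sub: "Y - ground N \<subseteq> U \<longleftrightarrow> True" if "Y \<subseteq> ground N" for Y U
    using that by blast
  ultimately have "W \<in> members (N \<^bold>+ ground N)"
    using member_subset_ground[OF assms(1) W(1)] by (simp add: in_members_loop_compl cong: conj_cong)
  moreover have "min_size N \<le> card Y" if Y: "Y \<in> members (N \<^bold>+ ground N)" for Y
  proof -
    have "{U \<in> members N. Y - ground N \<subseteq> U \<and> U \<subseteq> Y} \<noteq> {}"
      using Y unfolding in_members_loop_compl by (metis card.empty even_zero)
    then obtain U where "U \<in> members N" "U \<subseteq> Y" by blast
    then show ?thesis
      using min_size_le[OF assms(1)] card_mono[of Y U]
        finite_member[OF set_system_loop_compl[OF assms(1)] Y] by (meson order_trans)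
  qed
  ultimately show ?thesis
    using W(2) set_system_loop_compl[OF assms(1)] by (blast intro: min_size_eqI)
qed

lemma min_size_twist_ground_dual_pivot:
  assumes "set_system M" "proper_system M" "X \<subseteq> ground M"
  shows "min_size (M \<^bold>* ground M \<^bold>*\<^bold>- X) = min_size (M \<^bold>*\<^bold>- ground M \<^bold>* (ground M - X))"
proof -
  let ?S = "M \<^bold>*\<^bold>- ground M \<^bold>* (ground M - X)"
  have "set_system ?S" "proper_system ?S"
    using assms by (auto intro!: set_system_twist set_system_dual_pivot proper_system_twist
        proper_system_dual_pivot)
  then show ?thesis
    using min_size_loop_compl_ground[of ?S] assms by (simp add: twist_ground_dual_pivot)
qed

lemma even_card_sym_diff:
  assumes "finite A" "finite B"
  shows "even (card (sym_diff A B)) \<longleftrightarrow> even (card A + card B)"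
proof -
  have "card (sym_diff A B) = card (A - B) + card (B - A)"
    using assms by (intro card_Un_disjoint) auto
  moreover have "card A = card (A - B) + card (A \<inter> B)" "card B = card (B - A) + card (A \<inter> B)"
    using assms by (metis card_Diff_subset_Int card_mono finite_Int inf_le1 inf_le2 inf_commute le_add_diff_inverse2)+
  ultimately show ?thesis by (simp only:) presburger
qed

lemma even_min_size_twist:
  assumes "set_system N" "proper_system N" "even_system N" "X \<subseteq> ground N" "Y \<subseteq> ground N"
  shows "even (min_size (N \<^bold>* X) + card X) \<longleftrightarrow> even (min_size (N \<^bold>* Y) + card Y)"
proof -
  have "\<exists>U \<in> members N. even (min_size (N \<^bold>* X) + card X) \<longleftrightarrow> even (card U)"
    if X: "X \<subseteq> ground N" for X
  proof -
    obtain W where W: "W \<in> members (N \<^bold>* X)" "card W = min_size (N \<^bold>* X)"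
      using min_size_attained[OF set_system_twist proper_system_twist] assms X by blast
    have "finite W" "finite X"
      using finite_member[OF set_system_twist[OF assms(1) X] W(1)] X assms(1) finite_subset
      by (auto simp: set_system_def)
    then show ?thesis
      using W even_card_sym_diff[of W X] by (auto simp: in_members_twist)
  qed
  then show ?thesis
    using assms unfolding even_system_def by meson
qed

section \<open>Single-element operations and vf-safety\<close>

lemma in_members_dual_pivot_single:
  assumes "set_system N" "v \<in> ground N"
  shows "Y \<in> members (N \<^bold>*\<^bold>- {v}) \<longleftrightarrow>
    (if v \<in> Y then Y \<in> members N else (Y \<in> members N) \<noteq> (insert v Y \<in> members N))"
proof -
  have sub: "Y \<in> members N \<Longrightarrow> Y \<subseteq> ground N" "insert v Y \<in> members N \<Longrightarrow> Y \<subseteq> ground N"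
    using member_subset_ground[OF assms(1)] by auto
  have "{W \<in> members N. Y \<subseteq> W \<and> W \<subseteq> Y \<union> {v}} = {W \<in> {Y, insert v Y}. W \<in> members N}"
    by auto
  also have "\<dots> = (if Y \<in> members N then {Y} else {}) \<union>
      (if insert v Y \<in> members N then {insert v Y} else {})"
    by auto
  finally show ?thesis
    using sub by (auto simp: in_members_dual_pivot insert_absorb card_insert_if split: if_splits)
qed

lemma in_members_loop_compl_single:
  assumes "set_system N" "x \<in> ground N"
  shows "Y \<in> members (N \<^bold>+ {x}) \<longleftrightarrow>
    (if x \<in> Y then (Y \<in> members N) \<noteq> (Y - {x} \<in> members N) else Y \<in> members N)"
proof -
  have sub: "Y \<in> members N \<Longrightarrow> Y \<subseteq> ground N" "Y - {x} \<in> members N \<Longrightarrow> Y \<subseteq> ground N"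
    using member_subset_ground[OF assms(1)] assms(2) by auto
  have "{W \<in> members N. Y - {x} \<subseteq> W \<and> W \<subseteq> Y} = {W \<in> {Y, Y - {x}}. W \<in> members N}"
    by auto
  also have "\<dots> = (if Y \<in> members N then {Y} else {}) \<union>
      (if Y - {x} \<in> members N then {Y - {x}} else {})"
    by auto
  finally show ?thesis
    using sub by (auto simp: in_members_loop_compl card_insert_if split: if_splits)
qed

lemma vf_reachable_trans: "vf_reachable M N \<Longrightarrow> vf_reachable N N' \<Longrightarrow> vf_reachable M N'"
  by (rotate_tac, induction rule: vf_reachable.induct) (auto intro: vf_reachable.intros)

lemma vf_reachable_dual_pivot: "X \<subseteq> ground M \<Longrightarrow> vf_reachable M (M \<^bold>*\<^bold>- X)"
  unfolding dual_pivot_eq_twist_loop_compl_twist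
  by (intro vf_reachable.intros) auto

lemma vf_safe_reachable:
  "vf_safe_delta_matroid M \<Longrightarrow> vf_reachable M N \<Longrightarrow> vf_safe_delta_matroid N"
  unfolding vf_safe_delta_matroid_def using vf_reachable_trans by blast

lemma vf_safe_twist:
  "vf_safe_delta_matroid M \<Longrightarrow> X \<subseteq> ground M \<Longrightarrow> vf_safe_delta_matroid (M \<^bold>* X)"
  by (meson vf_safe_reachable vf_reachable.intros)

lemma vf_safe_loop_compl:
  "vf_safe_delta_matroid M \<Longrightarrow> X \<subseteq> ground M \<Longrightarrow> vf_safe_delta_matroid (M \<^bold>+ X)"
  by (meson vf_safe_reachable vf_reachable.intros)

lemma vf_safe_dual_pivot:
  "vf_safe_delta_matroid M \<Longrightarrow> X \<subseteq> ground M \<Longrightarrow> vf_safe_delta_matroid (M \<^bold>*\<^bold>- X)"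
  by (meson vf_safe_reachable vf_reachable_dual_pivot)

lemma vf_safe_imp_delta_matroid: "vf_safe_delta_matroid M \<Longrightarrow> delta_matroid M"
  by (simp add: vf_safe_delta_matroid_def)

lemma vf_safe_set_system: "vf_safe_delta_matroid M \<Longrightarrow> set_system M"
  by (simp add: vf_safe_delta_matroid_def delta_matroid_def)

lemma vf_safe_proper_system: "vf_safe_delta_matroid M \<Longrightarrow> proper_system M"
  by (simp add: vf_safe_delta_matroid_def delta_matroid_def)

section \<open>Exchange at the bottom level\<close>

lemma delta_matroid_exchange:
  assumes "delta_matroid N" "X \<in> members N" "Y \<in> members N" "x \<in> sym_diff X Y"
  obtains y where "y \<in> sym_diff X Y" "sym_diff X {x, y} \<in> members N"
  using assms unfolding delta_matroid_def by blast

text \<open>The forbidden configuration: up to a loop complementation at \<open>x\<close>, the set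
  \<open>insert v (insert y A)\<close> is not a member, and then the exchange of \<open>v\<close> fails.\<close>

lemma vf_safe_adjacent_exchange:
  assumes safe: "vf_safe_delta_matroid S"
    and v: "v \<in> ground S" "v \<notin> A" "v \<noteq> y"
    and A: "x \<in> A" "y \<notin> A" "A \<in> members S" "insert v A \<notin> members S"
    and low: "A - {x} \<notin> members S" "insert v (A - {x}) \<notin> members S"
  shows "insert v (insert y (A - {x})) \<notin> members S"
proof
  assume B: "insert v (insert y (A - {x})) \<in> members S"
  note ss = vf_safe_set_system[OF safe]
  have x: "x \<in> ground S" "v \<noteq> x" "x \<noteq> y"
    using A v member_subset_ground[OF ss] by auto
  \<comment> \<open>Loop complementation at \<open>x\<close> toggles a set containing
    \<open>x\<close> exactly when removing \<open>x\<close> from it gives a member. It thus removes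
    \<open>insert v (insert y A)\<close>, because of \<open>B\<close>, and leaves \<open>A\<close>
    and \<open>insert v A\<close> alone, because of \<open>low\<close>.\<close>
  define T where "T = (if insert v (insert y A) \<in> members S then S \<^bold>+ {x} else S)"
  have dm: "delta_matroid T"
    using safe x by (auto simp: T_def intro: vf_safe_imp_delta_matroid vf_safe_loop_compl)
  have rem: "insert v A - {x} = insert v (A - {x})"
    "insert v (insert y A) - {x} = insert v (insert y (A - {x}))"
    using x by auto
  have T: "A \<in> members T" "insert v (insert y (A - {x})) \<in> members T"
    "insert v A \<notin> members T" "insert v (A - {x}) \<notin> members T"
    "insert v (insert y A) \<notin> members T"
    using A B low x v by (auto simp: T_def in_members_loop_compl_single[OF ss] rem)
  have diff: "sym_diff A (insert v (insert y (A - {x}))) = {v, x, y}"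
    using A v x by auto
  have "v \<in> sym_diff A (insert v (insert y (A - {x})))"
    unfolding diff by simp
  then obtain z where "z \<in> {v, x, y}" "sym_diff A {v, z} \<in> members T"
    using delta_matroid_exchange[OF dm T(1,2)] unfolding diff by blast
  moreover have "sym_diff A {v, v} = insert v A" "sym_diff A {v, x} = insert v (A - {x})"
    "sym_diff A {v, y} = insert v (insert y A)"
    using A v x by auto
  ultimately show False
    using T(3-5) by (metis empty_iff insert_iff)
qed

text \<open>A basis exchange walk at the bottom level \<open>m\<close>, inside \<open>S\<close> or inside \<open>S \<^bold>*\<^bold>- {v}\<close>, leads from
  \<open>A\<close> to \<open>B\<close>; the first step at which \<open>insert v A\<close> becomes a member is the forbidden
  configuration.\<close>

lemma vf_safe_bottom_level_subset:
  assumes safe: "vf_safe_delta_matroid S" and v: "v \<in> ground S"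
    and low: "\<And>W. W \<in> members S \<Longrightarrow> m \<le> card (W - {v})"
    and B: "v \<notin> B" "card B = m" "insert v B \<in> members S"
    and A: "v \<notin> A" "card A = m" "A \<in> members S"
  shows "insert v A \<in> members S"
  using A
proof (induction "card (A - B)" arbitrary: A rule: less_induct)
  case less
  show ?case
  proof (rule ccontr)
    assume nA: "insert v A \<notin> members S"
    note ss = vf_safe_set_system[OF safe]
    have fin: "finite A" "finite B"
      using finite_member[OF ss less.prems(3)] finite_member[OF ss B(3)] by auto
    have "A \<noteq> B" using nA B by auto
    then have "\<not> A \<subseteq> B" using fin B(2) less.prems(2) by (metis card_subset_eq)
    then obtain x where x: "x \<in> A" "x \<notin> B" by blast
    have mpos: "m > 0" using x fin less.prems(2) card_gt_0_iff by blast
    \<comment> \<open>The exchange needs \<open>B\<close> as a member. If it is not one, the dual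
      pivot at \<open>v\<close> makes it one because of \<open>insert v B\<close>, and keeps
      \<open>A\<close> because \<open>insert v A\<close> is not a member.\<close>
    define T where "T = (if B \<in> members S then S else S \<^bold>*\<^bold>- {v})"
    have dm: "delta_matroid T"
      using safe v by (auto simp: T_def intro: vf_safe_imp_delta_matroid vf_safe_dual_pivot)
    have T_in: "A \<in> members T" "B \<in> members T"
      using less.prems B nA by (auto simp: T_def in_members_dual_pivot_single[OF ss v])
    have low_T: "m \<le> card W" if "W \<in> members T" "v \<notin> W" for W
      using that low[of W] low[of "insert v W"]
      by (auto simp: T_def in_members_dual_pivot_single[OF ss v] split: if_splits)
    obtain y where y: "y \<in> sym_diff A B" "sym_diff A {x, y} \<in> members T"
      using delta_matroid_exchange[OF dm T_in, of x] x by auto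
    have yv: "v \<noteq> y" "v \<noteq> x" using y x less.prems B by auto
    \<comment> \<open>A partner \<open>y\<close> in \<open>A\<close>, including
      \<open>y = x\<close>, would produce a member avoiding \<open>v\<close> with fewer than
      \<open>m\<close> elements.\<close>
    have yB: "y \<in> B" "y \<notin> A"
    proof -
      have "y \<notin> A"
      proof
        assume "y \<in> A"
        then have "sym_diff A {x, y} \<subset> A" using x by auto
        then have "card (sym_diff A {x, y}) < m"
          using fin less.prems(2) psubset_card_mono by blast
        moreover have "v \<notin> sym_diff A {x, y}" using less.prems(1) yv by auto
        ultimately show False using low_T[OF y(2)] by simp
      qed
      then show "y \<in> B" "y \<notin> A" using y by auto
    qed
    define A' where "A' = insert y (A - {x})"
    have A'T: "A' \<in> members T"
    proof -
      have "sym_diff A {x, y} = A'" using x yB by (auto simp: A'_def)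
      then show ?thesis using y by simp
    qed
    have A': "v \<notin> A'" "card A' = m"
      using less.prems yv yB x fin mpos by (auto simp: A'_def)
    have small: "m > card (A - {x})" using x fin mpos less.prems(2) by auto
    have "A - {x} \<notin> members S" "insert v (A - {x}) \<notin> members S"
      using low[of "A - {x}"] low[of "insert v (A - {x})"] small less.prems(1) by auto
    then have "insert v A' \<notin> members S"
      unfolding A'_def using vf_safe_adjacent_exchange[OF safe v] less.prems nA x yB yv by blast
    \<comment> \<open>In the dual pivot, exactly one of \<open>A'\<close> and
      \<open>insert v A'\<close> belongs to \<open>S\<close>, and the latter is excluded. So
      \<open>A'\<close> is a counterexample closer to \<open>B\<close>.\<close>
    moreover from this have "A' \<in> members S"
      using A'T A' by (auto simp: T_def in_members_dual_pivot_single[OF ss v] split: if_splits)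
    moreover have "card (A' - B) < card (A - B)"
      by (rule psubset_card_mono) (use fin x yB in \<open>auto simp: A'_def\<close>)
    ultimately show False
      using less.hyps A' by blast
  qed
qed

text \<open>Two of the three minimum sizes are equal and the third is larger by one.\<close>

lemma vf_safe_min_size_tight:
  assumes safe: "vf_safe_delta_matroid S" and v: "v \<in> ground S"
  shows "(-2::int) ^ min_size S + (-2) ^ min_size (S \<^bold>* {v}) = - ((-2) ^ min_size (S \<^bold>*\<^bold>- {v}))"
proof -
  note ss = vf_safe_set_system[OF safe]
  \<comment> \<open>Ignoring \<open>v\<close> gives a lower bound common to \<open>S\<close>, its
    twist and its dual pivot, as these differ only in how sets are joined with
    \<open>v\<close>.\<close>
  define m where "m = Min ((\<lambda>W. card (W - {v})) ` members S)"
  have fin: "finite (members S)" using ss by (rule set_system_finite_members)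
  have low: "m \<le> card (W - {v})" if "W \<in> members S" for W
    using that fin by (simp add: m_def)
  have tw: "W \<in> members (S \<^bold>* {v}) \<longleftrightarrow> (if v \<in> W then W - {v} \<in> members S else insert v W \<in> members S)" for W
  proof -
    have "sym_diff W {v} = (if v \<in> W then W - {v} else insert v W)" by auto
    then show ?thesis by (simp add: in_members_twist)
  qed
  note dp = in_members_dual_pivot_single[OF ss v]
  have low_tw: "m \<le> card (W - {v})" if "W \<in> members (S \<^bold>* {v})" for W
    using that low[of "W - {v}"] low[of "insert v W"] by (auto simp: tw split: if_splits)
  have low_dp: "m \<le> card (W - {v})" if "W \<in> members (S \<^bold>*\<^bold>- {v})" for W
    using that low[of W] low[of "insert v W"] by (auto simp: dp split: if_splits)
  have ss_tw: "set_system (S \<^bold>* {v})" and ss_dp: "set_system (S \<^bold>*\<^bold>- {v})"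
    using ss v by (auto intro: set_system_twist set_system_dual_pivot)
  have size_m: "min_size T = m"
    if "set_system T" "\<And>W. W \<in> members T \<Longrightarrow> m \<le> card (W - {v})" "W \<in> members T" "card W = m" for T W
    using that(1,3,4)
  proof (rule min_size_eqI)
    fix U assume "U \<in> members T"
    then show "m \<le> card U"
      using that(2) finite_member[OF that(1)] by (meson Diff_subset card_mono order_trans)
  qed
  have size_Suc: "min_size T = Suc m"
    if T: "set_system T" "\<And>W. W \<in> members T \<Longrightarrow> m \<le> card (W - {v})" "insert v W \<in> members T"
      "v \<notin> W" "card W = m" "\<And>W. v \<notin> W \<Longrightarrow> card W = m \<Longrightarrow> W \<notin> members T" for T W
  proof (rule min_size_eqI[OF T(1,3)])
    show "card (insert v W) = Suc m" using finite_member[OF T(1,3)] T(4,5) by simp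
    fix U assume U: "U \<in> members T"
    show "Suc m \<le> card U"
    proof (cases "v \<in> U")
      case True
      then show ?thesis
        using T(2)[OF U] finite_member[OF T(1) U] by (metis Suc_le_mono card_Suc_Diff1)
    next
      case False
      then show ?thesis using T(2)[OF U] T(6)[of U] U by force
    qed
  qed
  have "m \<in> (\<lambda>W. card (W - {v})) ` members S"
    unfolding m_def using fin vf_safe_proper_system[OF safe]
    by (intro Min_in) (auto simp: proper_system_def)
  then obtain W0 where "W0 \<in> members S" "card (W0 - {v}) = m" by auto
  then have some: "\<exists>W. v \<notin> W \<and> card W = m \<and> (W \<in> members S \<or> insert v W \<in> members S)"
    by (intro exI[of _ "W0 - {v}"]) (cases "v \<in> W0"; simp add: insert_absorb)
  \<comment> \<open>The cases ask whether level \<open>m\<close> is reached only with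
    \<open>v\<close>, only without \<open>v\<close>, or both ways. The exceptional size
    \<open>Suc m\<close> then belongs to \<open>S\<close>, to the twist or to the dual pivot,
    respectively.\<close>
  consider
    (A_empty) "\<And>W. v \<notin> W \<Longrightarrow> card W = m \<Longrightarrow> W \<notin> members S"
    | (B_empty) "\<And>W. v \<notin> W \<Longrightarrow> card W = m \<Longrightarrow> insert v W \<notin> members S"
    | (both) A B where "v \<notin> A" "card A = m" "A \<in> members S" "v \<notin> B" "card B = m" "insert v B \<in> members S"
    by blast
  then show ?thesis
  proof cases
    case A_empty
    then obtain W where W: "v \<notin> W" "card W = m" "insert v W \<in> members S" "W \<notin> members S"
      using some by blast
    have "min_size S = Suc m"
      using size_Suc[OF ss low W(3,1,2)] A_empty by blast
    moreover have "min_size (S \<^bold>* {v}) = m"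
      using size_m[OF ss_tw low_tw _ W(2)] W by (simp add: tw)
    moreover have "min_size (S \<^bold>*\<^bold>- {v}) = m"
      using size_m[OF ss_dp low_dp _ W(2)] W by (simp add: dp)
    ultimately show ?thesis by simp
  next
    case B_empty
    then obtain W where W: "v \<notin> W" "card W = m" "W \<in> members S" "insert v W \<notin> members S"
      using some by blast
    have "min_size S = m"
      using size_m[OF ss low W(3,2)] by blast
    moreover have "min_size (S \<^bold>* {v}) = Suc m"
      using size_Suc[OF ss_tw low_tw _ W(1,2)] W B_empty by (simp add: tw)
    moreover have "min_size (S \<^bold>*\<^bold>- {v}) = m"
      using size_m[OF ss_dp low_dp _ W(2)] W by (simp add: dp)
    ultimately show ?thesis by simp
  next
    case both
    have safe': "vf_safe_delta_matroid (S \<^bold>* {v})"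
      using safe v by (simp add: vf_safe_twist)
    \<comment> \<open>The twist at \<open>v\<close> interchanges the roles of \<open>W\<close> and
      \<open>insert v W\<close>, so the second direction is the first one applied to it.\<close>
    have eq: "W \<in> members S \<longleftrightarrow> insert v W \<in> members S" if "v \<notin> W" "card W = m" for W
    proof
      show "W \<in> members S \<Longrightarrow> insert v W \<in> members S"
        using vf_safe_bottom_level_subset[OF safe v low both(4-6) that] by blast
      show "insert v W \<in> members S \<Longrightarrow> W \<in> members S"
        using vf_safe_bottom_level_subset[OF safe' _ low_tw both(1,2) _ that] v both(1,3) that(1)
        by (simp add: tw)
    qed
    have "min_size S = m"
      using size_m[OF ss low both(3,2)] by blast
    moreover have "min_size (S \<^bold>* {v}) = m"
      using size_m[OF ss_tw low_tw _ both(5)] both by (simp add: tw)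
    \<comment> \<open>By \<open>eq\<close>, \<open>W\<close> and \<open>insert v W\<close> cancel
      modulo 2 at level \<open>m\<close>, while \<open>insert v B\<close> remains.\<close>
    moreover have "min_size (S \<^bold>*\<^bold>- {v}) = Suc m"
      using size_Suc[OF ss_dp low_dp _ both(4,5)] both eq by (simp add: dp)
    ultimately show ?thesis by simp
  qed
qed

section \<open>Summation over all twists\<close>

lemma sum_min_size_dual_pivot_twist:
  assumes "finite U" "vf_safe_delta_matroid M" "U \<subseteq> ground M"
  shows "(\<Sum>B\<in>Pow U. (-2::int) ^ min_size (M \<^bold>*\<^bold>- U \<^bold>* B)) = (-1) ^ card U * (-2) ^ min_size M"
  using assms
proof (induction U arbitrary: M rule: finite_induct)
  case empty
  then show ?case
    by (simp add: dual_pivot_empty twist_empty vf_safe_set_system)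
next
  case (insert v U)
  define S where "S = M \<^bold>*\<^bold>- {v}"
  have ss: "set_system M" using insert.prems(1) by (rule vf_safe_set_system)
  have v: "v \<in> ground M" "U \<subseteq> ground M" using insert.prems by auto
  have safe: "vf_safe_delta_matroid S" "vf_safe_delta_matroid (S \<^bold>* {v})"
    using insert.prems v by (auto simp: S_def intro: vf_safe_dual_pivot vf_safe_twist)
  have S: "M \<^bold>*\<^bold>- insert v U = S \<^bold>*\<^bold>- U"
    using dual_pivot_dual_pivot_disjoint[OF ss v(2), of "{v}"] insert.hyps by (simp add: S_def)
  have tw: "S \<^bold>*\<^bold>- U \<^bold>* insert v B = S \<^bold>* {v} \<^bold>*\<^bold>- U \<^bold>* B" if "B \<in> Pow U" for B
  proof -
    have "v \<notin> B" using that insert.hyps by auto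
    then have "S \<^bold>*\<^bold>- U \<^bold>* insert v B = S \<^bold>*\<^bold>- U \<^bold>* {v} \<^bold>* B"
      using twist_twist_disjoint[of "{v}" B] by simp
    then show ?thesis
      using twist_dual_pivot_disjoint[of "{v}" U S] insert.hyps v by (simp add: S_def)
  qed
  let ?f = "\<lambda>B. (-2::int) ^ min_size (S \<^bold>*\<^bold>- U \<^bold>* B)"
  have "(\<Sum>B\<in>Pow (insert v U). ?f B) = (\<Sum>B\<in>Pow U. ?f B) + (\<Sum>B\<in>insert v ` Pow U. ?f B)"
    unfolding Pow_insert by (rule sum.union_disjoint) (use insert.hyps in auto)
  also have "(\<Sum>B\<in>insert v ` Pow U. ?f B) = (\<Sum>B\<in>Pow U. ?f (insert v B))"
  proof (subst sum.reindex)
    show "inj_on (insert v) (Pow U)" using insert.hyps by (auto simp: inj_on_def)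
  qed simp
  also have "\<dots> = (\<Sum>B\<in>Pow U. (-2) ^ min_size (S \<^bold>* {v} \<^bold>*\<^bold>- U \<^bold>* B))"
    by (rule sum.cong) (simp_all add: tw)
  also have "(\<Sum>B\<in>Pow U. ?f B) + \<dots> =
      (-1) ^ card U * ((-2) ^ min_size S + (-2) ^ min_size (S \<^bold>* {v}))"
    using insert.IH[OF safe(1)] insert.IH[OF safe(2)] v
    by (simp add: S_def algebra_simps)
  also have "(-2::int) ^ min_size S + (-2) ^ min_size (S \<^bold>* {v}) = - ((-2) ^ min_size M)"
    using vf_safe_min_size_tight[OF safe(1), of v] v dual_pivot_involution[OF ss, of "{v}"]
    by (simp add: S_def)
  finally show ?case
    using insert.hyps S by simp
qed

theorem theorem9:
  fixes M :: "'a set_system" and V :: "'a set"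
  assumes "set_system M" and "ground M = V" and "proper_system M"
    and "even_system (M \<^bold>*\<^bold>- V)"
  shows "P_poly M =
           smult ((-1) ^ min_size (M \<^bold>* V)) (pcompose (Q110_poly (M \<^bold>*\<^bold>- V)) [:0, -1:])
       \<and> poly (P_poly M) (-1) = (-1) ^ min_size (M \<^bold>* V) * 2 ^ card V
       \<and> (vf_safe_delta_matroid M \<longrightarrow>
            poly (P_poly M) 2 =
              (-1) ^ (min_size M + min_size (M \<^bold>* V) + card V) * 2 ^ min_size M)"
proof -
  define N where "N = M \<^bold>*\<^bold>- V"
  have fin: "finite V" using assms by (auto simp: set_system_def)
  have N: "set_system N" "proper_system N" "even_system N" "ground N = V"
    using assms by (auto simp: N_def intro: set_system_dual_pivot proper_system_dual_pivot)
  have size: "min_size (M \<^bold>* V \<^bold>*\<^bold>- X) = min_size (N \<^bold>* (V - X))" if "X \<subseteq> V" for X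
    using min_size_twist_ground_dual_pivot[OF assms(1,3)] that assms(2) by (simp add: N_def)
  have MV: "min_size (M \<^bold>* V) = min_size (N \<^bold>* V)"
    using size[of "{}"] assms(1,2) by (simp add: dual_pivot_empty set_system_twist)
  have sign: "(-1::int) ^ card (V - B) = (-1) ^ min_size (M \<^bold>* V) * (-1) ^ min_size (N \<^bold>* B)"
    if B: "B \<subseteq> V" for B
  proof -
    have "card V = card (V - B) + card B"
      using B fin by (metis card_Diff_subset card_mono finite_subset le_add_diff_inverse2)
    then have "even (card (V - B)) \<longleftrightarrow> even (min_size (M \<^bold>* V) + min_size (N \<^bold>* B))"
      using even_min_size_twist[OF N(1-3), of V B] N(4) B MV by auto
    then show ?thesis by (simp add: minus_one_power_iff flip: power_add)
  qed
  have P: "P_poly M = (\<Sum>B\<in>Pow V. (-1) ^ card (V - B) * monom 1 (min_size (N \<^bold>* B)))"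
    unfolding P_poly_def assms(2)
    by (rule sum.reindex_bij_witness[where i = "\<lambda>B. V - B" and j = "\<lambda>B. V - B"])
      (auto simp: size double_diff)
  have eval: "poly (P_poly M) y = (-1) ^ min_size (M \<^bold>* V) * (\<Sum>B\<in>Pow V. (-y) ^ min_size (N \<^bold>* B))" for y
  proof -
    have "poly (P_poly M) y = (\<Sum>B\<in>Pow V. (-1) ^ card (V - B) * y ^ min_size (N \<^bold>* B))"
      by (simp add: P poly_sum poly_monom)
    also have "\<dots> = (\<Sum>B\<in>Pow V. (-1) ^ min_size (M \<^bold>* V) * (-y) ^ min_size (N \<^bold>* B))"
    proof (rule sum.cong)
      fix B assume "B \<in> Pow V"
      then show "(-1) ^ card (V - B) * y ^ min_size (N \<^bold>* B) =
          (-1) ^ min_size (M \<^bold>* V) * (-y) ^ min_size (N \<^bold>* B)"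
        by (simp add: sign power_minus[of y])
    qed simp
    finally show ?thesis by (simp add: sum_distrib_left)
  qed
  have "P_poly M = smult ((-1) ^ min_size (M \<^bold>* V)) (pcompose (Q110_poly N) [:0, -1:])"
    by (rule poly_ext)
      (simp add: eval Q110_poly_def N(4) poly_pcompose poly_sum poly_monom)
  moreover have "poly (P_poly M) (-1) = (-1) ^ min_size (M \<^bold>* V) * 2 ^ card V"
    using fin by (simp add: eval card_Pow)
  \<comment> \<open>At 2 the summands in \<open>eval\<close> are powers of -2, so the collapsed sum
    applies with \<open>U = V\<close>.\<close>
  moreover have "poly (P_poly M) 2 =
      (-1) ^ (min_size M + min_size (M \<^bold>* V) + card V) * 2 ^ min_size M"
    if "vf_safe_delta_matroid M"
    using sum_min_size_dual_pivot_twist[OF fin that] assms(2)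
    by (simp add: eval N_def power_add power_minus[of "2::int"])
  ultimately show ?thesis by (simp add: N_def)
qed

end
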